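(* Let $X$ be a normed linear space, $Y$ a reflexive Banach space, and $T : X \to Y$ a bounded linear operator. Let $(P_n)$ be a sequence of bounded linear operators on $X$ and $(Q_n)$ a sequence of bounded linear operators on $Y$ such that $\|Q_n\|\,\|P_n\| \le 1$ for each $n \in \mathbb{N}$, and let $T_n := Q_n T P_n$. If $T_n$ converges to $T$ pointwise (that is, $\|T_n x - Tx\| \to 0$ for every $x \in X$), then for each $k \in \mathbb{N}$, $$\lim_{n\to\infty} \epsilon_k(T_n) = \epsilon_k(T).$$
   Context: For normed linear spaces $X, Y$ and a bounded linear operator $S : X \to Y$, let $U_X = \{x \in X : \|x\| \le 1\}$ be the closed unit ball of $X$ and, for $y_0 \in Y$ and $r>0$, let $U(y_0,r) = \{y \in Y : \|y-y_0\| \le r\}$. For $k \in \mathbb{N} = \{1,2,\dots\}$, the $k$-th entropy number of $S$ is $$\epsilon_k(S) := \inf\Big\{\epsilon>0 : \text{there exist } j \le k \text{ and } y_1,\dots,y_j \in Y \text{ such that } S(U_X) \subseteq \bigcup_{i=1}^j U(y_i,\epsilon)\Big\}.$$ *)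

theory Defs
  imports "HOL-Analysis.Analysis"
begin

definition bidual_embedding ::
    "'a::real_normed_vector \<Rightarrow> (('a \<Rightarrow>\<^sub>L real) \<Rightarrow>\<^sub>L real)" where
  "bidual_embedding y = Blinfun (\<lambda>f. blinfun_apply f y)"

text \<open>\<^term>\<open>Blinfun\<close> is only meaningful on bounded linear maps; evaluation at a point is one.\<close>

lemma bidual_embedding_apply [simp]:
  "blinfun_apply (bidual_embedding y) f = blinfun_apply f y"
  unfolding bidual_embedding_def
  by (simp add: bounded_linear_Blinfun_apply blinfun.bounded_linear_left)

text \<open>Reflexivity is a property of the whole space, hence of a type; the argument only selects
  the type.\<close>

definition reflexive_space :: "'a::real_normed_vector itself \<Rightarrow> bool" where
  "reflexive_space _ \<longleftrightarrow>
     surj (bidual_embedding :: 'a \<Rightarrow> (('a \<Rightarrow>\<^sub>L real) \<Rightarrow>\<^sub>L real))"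

text \<open>The index \<open>k\<close> ranges over the positive integers. For \<open>k = 0\<close> the set below is empty and its
  real infimum is a junk value; for \<open>k \<ge> 1\<close> it is nonempty and bounded below by \<open>0\<close>.\<close>

definition entropy_number ::
    "nat \<Rightarrow> ('a::real_normed_vector \<Rightarrow>\<^sub>L 'b::real_normed_vector) \<Rightarrow> real" where
  "entropy_number k S =
     Inf {\<epsilon>. \<epsilon> > 0 \<and> (\<exists>j\<in>{1..k}. \<exists>y :: nat \<Rightarrow> 'b.
            blinfun_apply S ` cball 0 1 \<subseteq> (\<Union>i\<in>{1..j}. cball (y i) \<epsilon>))}"

end

theory Submission
  imports Defs
begin

text \<open>If \<open>T\<close> maps the unit ball into \<open>k\<close> balls with centres \<open>y\<^sub>i\<close> and radius \<open>\<epsilon>\<close>, then \<open>Q T P\<close> maps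
  it into the balls with centres \<open>\<parallel>P\<parallel> Q y\<^sub>i\<close> and the same radius, so \<open>\<epsilon>\<^sub>k(T\<^sub>n) \<le> \<epsilon>\<^sub>k(T)\<close>. Conversely, if
  infinitely many \<open>T\<^sub>n\<close> admit a cover of radius \<open>\<epsilon>\<close>, the centres may be taken bounded; by Tychonoff
  the tuples of their evaluation functionals on the dual have a pointwise cluster point, and
  reflexivity turns it into a tuple of points \<open>y\<^sub>i\<close>. If \<open>T x\<close> were outside every \<open>cball y\<^sub>i \<epsilon>\<close>,
  norming functionals of the vectors \<open>T x - y\<^sub>i\<close> would separate \<open>T\<^sub>n x\<close> from all \<open>k\<close> balls for some
  such \<open>n\<close>. Hence \<open>\<epsilon>\<^sub>k(T) \<le> \<epsilon>\<close>.\<close>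

section \<open>Norming functionals\<close>

definition sublinear :: "('a::real_vector \<Rightarrow> real) \<Rightarrow> bool" where
  "sublinear q \<longleftrightarrow> (\<forall>x y. q (x + y) \<le> q x + q y) \<and> (\<forall>c\<ge>0. \<forall>x. q (c *\<^sub>R x) = c * q x)"

text \<open>The inequality for \<open>inverse c\<close> is the reverse inequality for
  \<open>c\<close>, and the factors 2 and 1/2 together force \<open>q 0 = 0\<close>.\<close>

lemma sublinearI:
  assumes add: "\<And>x y. q (x + y) \<le> q x + q y"
    and scale: "\<And>c x. c > 0 \<Longrightarrow> q (c *\<^sub>R x) \<le> c * q x"
  shows "sublinear q"
proof -
  have zero: "q 0 = 0"
    using scale[of 2 0] scale[of "1/2" 0] by simp
  have "q (c *\<^sub>R x) = c * q x" if "c \<ge> 0" for c x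
  proof (cases "c = 0")
    case False
    then have c: "c > 0" using that by simp
    have "q x \<le> inverse c * q (c *\<^sub>R x)"
      using scale[of "inverse c" "c *\<^sub>R x"] c by simp
    then have "c * q x \<le> q (c *\<^sub>R x)"
      using c by (simp add: field_simps)
    then show ?thesis using scale[OF c, of x] by simp
  qed (simp add: zero)
  then show ?thesis unfolding sublinear_def using add by blast
qed

lemma sublinear_add: "sublinear q \<Longrightarrow> q (x + y) \<le> q x + q y"
  and sublinear_scale: "sublinear q \<Longrightarrow> c \<ge> 0 \<Longrightarrow> q (c *\<^sub>R x) = c * q x"
  unfolding sublinear_def by blast+

lemma sublinear_zero: "sublinear q \<Longrightarrow> q 0 = 0"
  using sublinear_scale[of q 0 0] by simp

lemma sublinear_ge_neg: "sublinear q \<Longrightarrow> - q (- x) \<le> q x"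
  using sublinear_add[of q x "- x"] sublinear_zero[of q] by simp

lemma sublinear_norm: "sublinear norm"
  by (rule sublinearI) (auto simp: norm_triangle_ineq)

text \<open>Lowering \<open>q\<close> in the direction \<open>-y\<close>: a sublinear function that cannot be lowered in any
  direction is linear, and one lowered in the direction \<open>-y\<close> is bounded by \<open>-q y\<close> at \<open>-y\<close>.\<close>

definition lowered :: "'a::real_vector \<Rightarrow> ('a \<Rightarrow> real) \<Rightarrow> 'a \<Rightarrow> real" where
  "lowered y q x = (INF t\<in>{0..}. q (x + t *\<^sub>R y) - t * q y)"

lemma lowered_le:
  assumes "sublinear q" "t \<ge> 0"
  shows "lowered y q x \<le> q (x + t *\<^sub>R y) - t * q y"
proof -
  \<comment> \<open>A lower bound independent of \<open>s\<close>, so that the real infimum in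
    \<open>lowered\<close> is a genuine one.\<close>
  have "- q (- x) \<le> q (x + s *\<^sub>R y) - s * q y" if "s \<ge> 0" for s
    using sublinear_add[OF assms(1), of "x + s *\<^sub>R y" "- x"]
      sublinear_scale[OF assms(1) that, of y] by simp
  then have "bdd_below ((\<lambda>s. q (x + s *\<^sub>R y) - s * q y) ` {0..})"
    by (intro bdd_belowI2[where m = "- q (- x)"]) auto
  then show ?thesis
    unfolding lowered_def using assms(2) by (intro cINF_lower) auto
qed

lemma lowered_greatest:
  assumes "\<And>t. t \<ge> 0 \<Longrightarrow> m \<le> q (x + t *\<^sub>R y) - t * q y"
  shows "m \<le> lowered y q x"
  unfolding lowered_def using assms by (intro cINF_greatest) auto

lemma lowered_le_self: "sublinear q \<Longrightarrow> lowered y q x \<le> q x"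
  using lowered_le[of q 0 y x] by simp

lemma lowered_uminus_le: "sublinear q \<Longrightarrow> lowered y q (- y) \<le> - q y"
  using lowered_le[of q 1 y "- y"] sublinear_zero[of q] by simp

lemma sublinear_lowered:
  assumes q: "sublinear q"
  shows "sublinear (lowered y q)"
proof (rule sublinearI)
  fix x z
  \<comment> \<open>The shifts \<open>s\<close> for \<open>x\<close> and \<open>t\<close> for
    \<open>z\<close> add up to the shift \<open>s + t\<close> for \<open>x + z\<close>; the infima
    over \<open>s\<close> and \<open>t\<close> are then taken one after the other.\<close>
  have *: "lowered y q (x + z) \<le> (q (x + s *\<^sub>R y) - s * q y) + (q (z + t *\<^sub>R y) - t * q y)"
    if "s \<ge> 0" "t \<ge> 0" for s t
  proof -
    have "x + z + (s + t) *\<^sub>R y = (x + s *\<^sub>R y) + (z + t *\<^sub>R y)"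
      by (simp add: algebra_simps)
    then show ?thesis
      using lowered_le[OF q, of "s + t" y "x + z"] that
        sublinear_add[OF q, of "x + s *\<^sub>R y" "z + t *\<^sub>R y"]
      by (simp add: algebra_simps)
  qed
  have "lowered y q (x + z) - (q (z + t *\<^sub>R y) - t * q y) \<le> lowered y q x" if "t \<ge> 0" for t
    by (rule lowered_greatest) (use *[OF _ that] in \<open>simp add: algebra_simps\<close>)
  then have "lowered y q (x + z) - lowered y q x \<le> lowered y q z"
    by (intro lowered_greatest) (simp add: algebra_simps)
  then show "lowered y q (x + z) \<le> lowered y q x + lowered y q z"
    by simp
next
  fix c :: real and x
  assume c: "c > 0"
  have "lowered y q (c *\<^sub>R x) / c \<le> lowered y q x"
  proof (rule lowered_greatest)
    fix t :: real
    assume "t \<ge> 0"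
    then have "lowered y q (c *\<^sub>R x) \<le> q (c *\<^sub>R x + (c * t) *\<^sub>R y) - c * t * q y"
      using c by (intro lowered_le[OF q]) simp
    also have "c *\<^sub>R x + (c * t) *\<^sub>R y = c *\<^sub>R (x + t *\<^sub>R y)"
      by (simp add: algebra_simps)
    finally show "lowered y q (c *\<^sub>R x) / c \<le> q (x + t *\<^sub>R y) - t * q y"
      using c sublinear_scale[OF q, of c "x + t *\<^sub>R y"] by (simp add: field_simps)
  qed
  then show "lowered y q (c *\<^sub>R x) \<le> c * lowered y q x"
    using c by (simp add: field_simps)
qed

text \<open>Minimality makes \<open>lowered y q\<close> equal to \<open>q\<close> for every
  \<open>y\<close>, and the shift \<open>t = 1\<close> then gives superadditivity. Additivity makes
  \<open>q\<close> odd, which settles negative scalars.\<close>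

lemma minimal_sublinear_linear:
  assumes q: "sublinear q"
    and minimal: "\<And>r. sublinear r \<Longrightarrow> (\<And>x. r x \<le> q x) \<Longrightarrow> r = q"
  shows "linear q"
proof -
  have "lowered y q = q" for y
    by (intro minimal sublinear_lowered lowered_le_self q)
  then have "q x \<le> q (x + y) - q y" for x y
    using lowered_le[OF q, of 1 y x] by simp
  then have add: "q (x + y) = q x + q y" for x y
    using sublinear_add[OF q, of x y] by (simp add: antisym le_diff_eq)
  have neg: "q (- x) = - q x" for x
    using add[of x "- x"] sublinear_zero[OF q] by simp
  show ?thesis
  proof (rule linearI)
    show "q (c *\<^sub>R x) = c *\<^sub>R q x" for c x
    proof (cases "c \<ge> 0")
      case False
      then show ?thesis
        using neg[of "c *\<^sub>R x"] sublinear_scale[OF q, of "- c" x] by simp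
    qed (simp add: sublinear_scale[OF q])
  qed (rule add)
qed

text \<open>Supplies the bounds for Zorn's lemma. The infima are finite since
  \<open>- p (- x) \<le> - q (- x) \<le> q x\<close>; subadditivity survives because two members of
  the chain can both be replaced by the smaller one.\<close>

lemma sublinear_Inf_chain:
  assumes ne: "C \<noteq> {}"
    and sub: "\<And>q. q \<in> C \<Longrightarrow> sublinear q"
    and dom: "\<And>q x. q \<in> C \<Longrightarrow> q x \<le> p x"
    and chain: "\<And>q r. q \<in> C \<Longrightarrow> r \<in> C \<Longrightarrow> (\<forall>x. q x \<le> r x) \<or> (\<forall>x. r x \<le> q x)"
  shows "sublinear (\<lambda>x. INF q\<in>C. q x)" (is "sublinear ?u")
    and "\<And>q x. q \<in> C \<Longrightarrow> (INF q\<in>C. q x) \<le> q x"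
proof -
  have "bdd_below ((\<lambda>q. q x) ` C)" for x
  proof (rule bdd_belowI2)
    show "- p (- x) \<le> q x" if "q \<in> C" for q
      using sublinear_ge_neg[OF sub[OF that], of x] dom[OF that, of "- x"] by simp
  qed
  then show lower: "?u x \<le> q x" if "q \<in> C" for q x
    using that by (intro cINF_lower) auto
  show "sublinear ?u"
  proof (rule sublinearI)
    fix x y
    have *: "?u (x + y) \<le> q x + r y" if q: "q \<in> C" and r: "r \<in> C" for q r
    proof -
      obtain s where "s \<in> C" "s x \<le> q x" "s y \<le> r y"
        using chain[OF q r] q r by blast
      then show ?thesis
        using lower[of s "x + y"] sublinear_add[OF sub, of s x y] by fastforce
    qed
    have "?u (x + y) - r y \<le> ?u x" if "r \<in> C" for r
      by (rule cINF_greatest[OF ne]) (use *[OF _ that] in \<open>simp add: algebra_simps\<close>)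
    then have "?u (x + y) - ?u x \<le> ?u y"
      by (intro cINF_greatest[OF ne]) (simp add: algebra_simps)
    then show "?u (x + y) \<le> ?u x + ?u y" by simp
  next
    fix c :: real and x
    assume c: "c > 0"
    have "?u (c *\<^sub>R x) / c \<le> ?u x"
    proof (rule cINF_greatest[OF ne])
      fix q assume q: "q \<in> C"
      then show "?u (c *\<^sub>R x) / c \<le> q x"
        using lower[OF q, of "c *\<^sub>R x"] sublinear_scale[OF sub[OF q], of c x] c
        by (simp add: field_simps)
    qed
    then show "?u (c *\<^sub>R x) \<le> c * ?u x"
      using c by (simp add: field_simps)
  qed
qed

theorem Hahn_Banach_sublinear:
  assumes p: "sublinear p"
  obtains f where "linear f" "\<And>x. f x \<le> p x"
proof -
  define A where "A = {q. sublinear q \<and> (\<forall>x. q x \<le> p x)}"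
  \<comment> \<open>\<open>R\<close> reverses the pointwise order, so a maximal element from Zorn's
    lemma is a minimal sublinear function.\<close>
  define R :: "('a \<Rightarrow> real) \<Rightarrow> ('a \<Rightarrow> real) \<Rightarrow> bool" where "R q r \<longleftrightarrow> (\<forall>x. r x \<le> q x)" for q r
  have "\<exists>m\<in>A. \<forall>a\<in>A. R m a \<longrightarrow> a = m"
  proof (rule predicate_Zorn)
    show "partial_order_on A (relation_of R A)"
      by (rule partial_order_on_relation_ofI)
        (auto simp: R_def intro: order_trans intro!: ext antisym)
  next
    fix C
    assume C: "C \<in> Chains (relation_of R A)"
    show "\<exists>u\<in>A. \<forall>a\<in>C. R a u"
    proof (cases "C = {}")
      case True
      then show ?thesis using p by (auto simp: A_def)
    next
      case False
      have CA: "C \<subseteq> A" using C by (auto simp: Chains_def relation_of_def)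
      have sub: "\<And>q. q \<in> C \<Longrightarrow> sublinear q" and dom: "\<And>q x. q \<in> C \<Longrightarrow> q x \<le> p x"
        using CA by (auto simp: A_def)
      have chain: "(\<forall>x. q x \<le> r x) \<or> (\<forall>x. r x \<le> q x)" if "q \<in> C" "r \<in> C" for q r
        using C that by (auto simp: Chains_def relation_of_def R_def)
      have u: "sublinear (\<lambda>x. INF q\<in>C. q x)"
        by (rule sublinear_Inf_chain(1)[where p = p]) (rule False sub dom chain; assumption?)+
      have u_le: "(INF q\<in>C. q x) \<le> q x" if "q \<in> C" for q x
        by (rule sublinear_Inf_chain(2)[where p = p]) (rule False sub dom chain that; assumption?)+
      have "(INF q\<in>C. q x) \<le> p x" for x
        using False u_le dom by (meson ex_in_conv order_trans)
      then show ?thesis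
        using u u_le by (intro bexI[of _ "\<lambda>x. INF q\<in>C. q x"]) (auto simp: A_def R_def)
    qed
  qed
  then obtain m where "m \<in> A" and minimal: "\<And>a. a \<in> A \<Longrightarrow> R m a \<Longrightarrow> a = m"
    by blast
  then have m: "sublinear m" "\<And>x. m x \<le> p x" by (auto simp: A_def)
  have "linear m"
  proof (rule minimal_sublinear_linear[OF m(1)])
    fix r assume "sublinear r" "\<And>x. r x \<le> m x"
    then show "r = m"
      using m(2) by (intro minimal) (auto simp: A_def R_def intro: order_trans)
  qed
  then show thesis using m(2) that by blast
qed

text \<open>Hahn-Banach is applied to the norm lowered in the direction \<open>- y\<close>: the
  resulting functional stays below the norm, yet its value at \<open>- y\<close> is at most
  \<open>- norm y\<close>, which forces equality at \<open>y\<close>.\<close>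

corollary norming_functional:
  fixes y :: "'a::real_normed_vector"
  obtains f :: "'a \<Rightarrow>\<^sub>L real" where "norm f \<le> 1" "blinfun_apply f y = norm y"
proof -
  obtain g where g: "linear g" "\<And>x. g x \<le> lowered y norm x"
    using Hahn_Banach_sublinear[OF sublinear_lowered[OF sublinear_norm]] by blast
  have le: "g x \<le> norm x" for x
    using g(2) lowered_le_self[OF sublinear_norm] by (rule order_trans)
  have abs_le: "\<bar>g x\<bar> \<le> norm x" for x
    using le[of x] le[of "- x"] by (simp add: linear_neg[OF g(1)] abs_le_iff)
  have "bounded_linear g"
    by (rule bounded_linear_intro[where K = 1])
      (simp_all add: linear_add[OF g(1)] linear_scale[OF g(1)] abs_le)
  then have app: "blinfun_apply (Blinfun g) = g"
    by (rule bounded_linear_Blinfun_apply)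
  have "g (- y) \<le> - norm y"
    using g(2) lowered_uminus_le[OF sublinear_norm] by (rule order_trans)
  then have "g y = norm y"
    using le[of y] by (simp add: linear_neg[OF g(1)])
  moreover have "norm (Blinfun g) \<le> 1"
    by (rule norm_blinfun_bound) (simp_all add: app abs_le)
  ultimately show thesis using that[of "Blinfun g"] app by simp
qed

section \<open>Bounded tuples in a reflexive space\<close>

text \<open>The first assumption says that \<open>x\<close> is a cluster point of \<open>F\<close>.
  Outside \<open>C\<close>, the open complement of \<open>C\<close> would be a neighbourhood of
  \<open>x\<close> that \<open>F\<close> eventually avoids.\<close>

lemma closed_cluster_point_mem:
  assumes "inf (nhds x) F \<noteq> bot" "closed C" "eventually (\<lambda>y. y \<in> C) F"
  shows "x \<in> C"
proof (rule ccontr)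
  assume "x \<notin> C"
  then have "eventually (\<lambda>y. y \<in> - C) (nhds x)"
    using assms(2) by (intro eventually_nhds_in_open) auto
  then have "eventually (\<lambda>y. False) (inf (nhds x) F)"
    using assms(3) unfolding eventually_inf by fastforce
  then show False using assms(1) by (simp add: trivial_limit_def)
qed

text \<open>Tychonoff's theorem, since functions carry the product topology.\<close>

lemma compact_product_intervals:
  fixes a b :: "'i \<Rightarrow> real"
  shows "compact {z. \<forall>p. a p \<le> z p \<and> z p \<le> b p}"
proof -
  have "compactin (product_topology (\<lambda>_::'i. euclidean :: real topology) UNIV)
      (PiE UNIV (\<lambda>p. {a p..b p}))"
    by (simp add: compactin_PiE)
  moreover have "PiE UNIV (\<lambda>p. {a p..b p}) = {z. \<forall>p. a p \<le> z p \<and> z p \<le> b p}"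
    by (auto simp: PiE_def Pi_def)
  ultimately show ?thesis
    by (simp add: euclidean_product_topology)
qed

lemma reflexive_representation:
  fixes \<phi> :: "('b::real_normed_vector \<Rightarrow>\<^sub>L real) \<Rightarrow> real"
  assumes "reflexive_space TYPE('b)" "bounded_linear \<phi>"
  obtains y where "\<And>f. blinfun_apply f y = \<phi> f"
proof -
  obtain y :: 'b where "Blinfun \<phi> = bidual_embedding y"
    using assms(1) unfolding reflexive_space_def by (meson surjD)
  then have "blinfun_apply f y = \<phi> f" for f
    using bidual_embedding_apply[of y f] bounded_linear_Blinfun_apply[OF assms(2)] by metis
  then show thesis using that by blast
qed

text \<open>The pairs \<open>(i, f)\<close> index the real numbers \<open>f (y\<^sub>i)\<close>. A single index set for the whole tuple
  makes one filter serve all \<open>i\<close> simultaneously.\<close>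

lemma reflexive_tuple_cluster_point:
  fixes c :: "'n \<Rightarrow> 'i \<Rightarrow> 'b::real_normed_vector"
  assumes refl: "reflexive_space TYPE('b)"
    and F: "F \<noteq> bot"
    and bounded: "\<And>n i. norm (c n i) \<le> M"
  obtains y where "\<And>C. closed C \<Longrightarrow>
      eventually (\<lambda>n. (\<lambda>(i, f :: 'b \<Rightarrow>\<^sub>L real). blinfun_apply f (c n i)) \<in> C) F \<Longrightarrow>
      (\<lambda>(i, f :: 'b \<Rightarrow>\<^sub>L real). blinfun_apply f (y i)) \<in> C"
proof -
  define g :: "'n \<Rightarrow> 'i \<times> ('b \<Rightarrow>\<^sub>L real) \<Rightarrow> real" where "g n = (\<lambda>(i, f :: 'b \<Rightarrow>\<^sub>L real). blinfun_apply f (c n i))" for n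
  \<comment> \<open>The compact box to which the estimate of \<open>f (c n i)\<close> by
    \<open>norm f * M\<close> confines every tuple.\<close>
  define K where "K = {z :: 'i \<times> ('b \<Rightarrow>\<^sub>L real) \<Rightarrow> real.
      \<forall>p. - (norm (snd p) * M) \<le> z p \<and> z p \<le> norm (snd p) * M}"
  have abs_g: "\<bar>g n p\<bar> \<le> norm (snd p) * M" for n p
  proof -
    have "\<bar>g n p\<bar> \<le> norm (snd p) * norm (c n (fst p))"
      using norm_blinfun[of "snd p" "c n (fst p)"] by (simp add: g_def case_prod_beta)
    also have "\<dots> \<le> norm (snd p) * M"
      by (intro mult_left_mono bounded) simp
    finally show ?thesis .
  qed
  have gK: "g n \<in> K" for n
    using abs_g[of n] by (auto simp: K_def abs_le_iff minus_le_iff)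
  have "compact K" unfolding K_def by (rule compact_product_intervals)
  moreover have "filtermap g F \<noteq> bot" using F by (simp add: filtermap_bot_iff)
  moreover have "eventually (\<lambda>z. z \<in> K) (filtermap g F)"
    by (simp add: eventually_filtermap gK)
  ultimately obtain z where "z \<in> K" and cluster: "inf (nhds z) (filtermap g F) \<noteq> bot"
    unfolding compact_filter by blast
  \<comment> \<open>Linearity in \<open>f\<close> is a family of closed conditions, each on finitely
    many coordinates, that hold at every \<open>g n\<close>; hence they pass to the cluster point.
    The norm bound comes from \<open>K\<close>.\<close>
  have zC: "z \<in> C" if "closed C" "\<And>n. g n \<in> C" for C
    using closed_cluster_point_mem[OF cluster that(1)] that(2) by (simp add: eventually_filtermap)
  have "bounded_linear (\<lambda>f. z (i, f))" for i
  proof (rule bounded_linear_intro)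
    show "z (i, f + h) = z (i, f) + z (i, h)" for f h
    proof -
      have "z \<in> {w. w (i, f + h) = w (i, f) + w (i, h)}"
        by (rule zC)
          (auto simp: g_def blinfun.add_left intro!: closed_Collect_eq continuous_intros)
      then show ?thesis by simp
    qed
    show "z (i, r *\<^sub>R f) = r *\<^sub>R z (i, f)" for r f
    proof -
      have "z \<in> {w. w (i, r *\<^sub>R f) = r *\<^sub>R w (i, f)}"
        by (rule zC)
          (auto simp: g_def blinfun.scaleR_left intro!: closed_Collect_eq continuous_intros)
      then show ?thesis by simp
    qed
    show "norm (z (i, f)) \<le> norm f * M" for f
      using \<open>z \<in> K\<close> by (auto simp: K_def abs_le_iff minus_le_iff dest: spec[of _ "(i, f)"])
  qed
  then have "\<exists>y. \<forall>f. blinfun_apply f y = z (i, f)" for i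
    using reflexive_representation[OF refl] by metis
  then obtain y where "\<And>i f. blinfun_apply f (y i) = z (i, f)" by metis
  then have z_eq: "(\<lambda>(i, f :: 'b \<Rightarrow>\<^sub>L real). blinfun_apply f (y i)) = z" by auto
  show thesis
  proof (rule that)
    fix C
    assume "closed C" "eventually (\<lambda>n. (\<lambda>(i, f :: 'b \<Rightarrow>\<^sub>L real). blinfun_apply f (c n i)) \<in> C) F"
    then show "(\<lambda>(i, f :: 'b \<Rightarrow>\<^sub>L real). blinfun_apply f (y i)) \<in> C"
      unfolding z_eq
      by (intro closed_cluster_point_mem[OF cluster]) (simp_all add: eventually_filtermap g_def)
  qed
qed

section \<open>Covers of the image of the unit ball\<close>

definition covers :: "nat \<Rightarrow> ('a::real_normed_vector \<Rightarrow>\<^sub>L 'b::real_normed_vector) \<Rightarrow>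
    real \<Rightarrow> (nat \<Rightarrow> 'b) \<Rightarrow> bool" where
  "covers k S \<epsilon> y \<longleftrightarrow> (\<forall>x. norm x \<le> 1 \<longrightarrow> (\<exists>i\<in>{1..k}. norm (blinfun_apply S x - y i) \<le> \<epsilon>))"

lemma coversE:
  assumes "covers k S \<epsilon> y" "norm x \<le> 1"
  obtains i where "i \<in> {1..k}" "norm (blinfun_apply S x - y i) \<le> \<epsilon>"
  using assms unfolding covers_def by blast

lemma covers_mono: "covers k S \<epsilon> y \<Longrightarrow> \<epsilon> \<le> \<delta> \<Longrightarrow> covers k S \<delta> y"
  unfolding covers_def by (meson order_trans)

text \<open>Exactly \<open>k\<close> centres may be used instead of at most \<open>k\<close>: superfluous ones do no harm.\<close>

lemma entropy_number_eq:
  assumes "k \<ge> 1"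
  shows "entropy_number k S = Inf {\<epsilon>. \<epsilon> > 0 \<and> (\<exists>y. covers k S \<epsilon> y)}"
proof -
  have "(\<exists>j\<in>{1..k}. \<exists>y. blinfun_apply S ` cball 0 1 \<subseteq> (\<Union>i\<in>{1..j}. cball (y i) \<epsilon>))
      \<longleftrightarrow> (\<exists>y. covers k S \<epsilon> y)" for \<epsilon>
  proof
    assume "\<exists>j\<in>{1..k}. \<exists>y. blinfun_apply S ` cball 0 1 \<subseteq> (\<Union>i\<in>{1..j}. cball (y i) \<epsilon>)"
    then obtain j y where j: "j \<le> k"
      and sub: "blinfun_apply S ` cball 0 1 \<subseteq> (\<Union>i\<in>{1..j}. cball (y i) \<epsilon>)"
      by auto
    have "covers k S \<epsilon> y"
      unfolding covers_def
    proof (intro allI impI)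
      fix x :: 'a assume "norm x \<le> 1"
      then have "blinfun_apply S x \<in> (\<Union>i\<in>{1..j}. cball (y i) \<epsilon>)"
        using sub by (auto simp: image_subset_iff)
      then obtain i where "i \<in> {1..j}" "dist (y i) (blinfun_apply S x) \<le> \<epsilon>" by auto
      then show "\<exists>i\<in>{1..k}. norm (blinfun_apply S x - y i) \<le> \<epsilon>"
        using j by (intro bexI[of _ i]) (auto simp: dist_norm norm_minus_commute)
    qed
    then show "\<exists>y. covers k S \<epsilon> y" by blast
  next
    assume "\<exists>y. covers k S \<epsilon> y"
    then obtain y where "covers k S \<epsilon> y" ..
    then have "blinfun_apply S ` cball 0 1 \<subseteq> (\<Union>i\<in>{1..k}. cball (y i) \<epsilon>)"
      by (auto simp: covers_def dist_norm norm_minus_commute)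
    then show "\<exists>j\<in>{1..k}. \<exists>y. blinfun_apply S ` cball 0 1 \<subseteq> (\<Union>i\<in>{1..j}. cball (y i) \<epsilon>)"
      using assms by (intro bexI[of _ k]) auto
  qed
  then show ?thesis unfolding entropy_number_def by simp
qed

lemma entropy_number_le:
  assumes "k \<ge> 1" "\<epsilon> > 0" "covers k S \<epsilon> y"
  shows "entropy_number k S \<le> \<epsilon>"
  unfolding entropy_number_eq[OF assms(1)]
  using assms(2,3) by (intro cInf_lower bdd_belowI[where m = 0]) auto

lemma covers_nonempty:
  assumes "k \<ge> 1"
  shows "{\<epsilon>. \<epsilon> > 0 \<and> (\<exists>y. covers k S \<epsilon> y)} \<noteq> {}"
proof -
  have "norm (blinfun_apply S x) \<le> norm S + 1" if "norm x \<le> 1" for x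
    using norm_blinfun[of S x] mult_left_mono[OF that norm_ge_zero[of S]] by simp
  \<comment> \<open>All centres are 0; the summand 1 keeps the radius positive even for
    \<open>S = 0\<close>.\<close>
  then have "covers k S (norm S + 1) (\<lambda>_. 0)"
    using assms unfolding covers_def by auto
  moreover have "norm S + 1 > 0" by (simp add: add_nonneg_pos)
  ultimately show ?thesis by blast
qed

lemma entropy_number_less_cover:
  assumes "k \<ge> 1" "entropy_number k S < \<epsilon>"
  obtains y where "\<epsilon> > 0" "covers k S \<epsilon> y"
proof -
  obtain \<delta> y where "\<delta> > 0" "covers k S \<delta> y" "\<delta> < \<epsilon>"
    using cInf_lessD[OF covers_nonempty[OF assms(1)]] assms(2)
    unfolding entropy_number_eq[OF assms(1)] by blast
  then show thesis using covers_mono[of k S \<delta> y \<epsilon>] that by force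
qed

text \<open>A ball of radius \<open>\<epsilon>\<close> whose centre has norm above
  \<open>M + \<epsilon>\<close> misses the image of the unit ball, so its centre can be moved to 0.
  The bound depends on the operator only through \<open>M\<close>.\<close>

lemma covers_bounded_centers:
  assumes cov: "covers k S \<epsilon> y" and "\<epsilon> > 0" "norm S \<le> M"
  obtains c where "covers k S \<epsilon> c" "\<And>i. norm (c i) \<le> M + \<epsilon>"
proof
  define c where "c i = (if norm (y i) \<le> M + \<epsilon> then y i else 0)" for i
  have "M \<ge> 0" using assms(3) norm_ge_zero[of S] by linarith
  then show "norm (c i) \<le> M + \<epsilon>" for i
    using assms(2) by (simp add: c_def)
  show "covers k S \<epsilon> c"
    unfolding covers_def
  proof (intro allI impI)
    fix x :: 'a assume x: "norm x \<le> 1"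
    obtain i where i: "i \<in> {1..k}" "norm (blinfun_apply S x - y i) \<le> \<epsilon>"
      using coversE[OF cov x] .
    have "norm (blinfun_apply S x) \<le> M"
      using norm_blinfun[of S x] mult_left_mono[OF x norm_ge_zero[of S]] assms(3) by simp
    then have "norm (y i) \<le> M + \<epsilon>"
      using i(2) norm_triangle_ineq3[of "y i" "blinfun_apply S x"]
      by (simp add: norm_minus_commute)
    then show "\<exists>i\<in>{1..k}. norm (blinfun_apply S x - c i) \<le> \<epsilon>"
      using i by (intro bexI[of _ i]) (simp_all add: c_def)
  qed
qed

section \<open>Entropy numbers do not increase under composition with
  \<open>norm Q * norm P \<le> 1\<close>\<close>

lemma covers_compose:
  fixes P :: "'c::real_normed_vector \<Rightarrow>\<^sub>L 'a::real_normed_vector"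
  assumes cov: "covers k T \<epsilon> y" and "\<epsilon> \<ge> 0" and PQ: "norm Q * norm P \<le> 1"
  shows "covers k (Q o\<^sub>L T o\<^sub>L P) \<epsilon> (\<lambda>i. norm P *\<^sub>R blinfun_apply Q (y i))"
  unfolding covers_def
proof (intro allI impI)
  fix x :: 'c assume x: "norm x \<le> 1"
  \<comment> \<open>\<open>P x\<close> rescaled into the unit ball, where the cover of
    \<open>T\<close> applies. For \<open>P = 0\<close> the convention \<open>inverse 0 = 0\<close>
    gives \<open>u = 0\<close>.\<close>
  define u where "u = inverse (norm P) *\<^sub>R blinfun_apply P x"
  have Px: "norm (blinfun_apply P x) \<le> norm P"
    using norm_blinfun[of P x] mult_left_mono[OF x norm_ge_zero[of P]] by simp
  then have Pu: "blinfun_apply P x = norm P *\<^sub>R u"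
    by (cases "P = 0") (auto simp: u_def)
  have "norm u \<le> 1"
    using Px by (cases "P = 0") (auto simp: u_def field_simps)
  then obtain i where i: "i \<in> {1..k}" "norm (blinfun_apply T u - y i) \<le> \<epsilon>"
    using coversE[OF cov] by blast
  have "norm (norm P *\<^sub>R blinfun_apply Q (blinfun_apply T u - y i))
      \<le> norm P * (norm Q * norm (blinfun_apply T u - y i))"
    by (simp add: norm_blinfun mult_left_mono)
  also have "\<dots> = norm Q * norm P * norm (blinfun_apply T u - y i)" by simp
  also have "\<dots> \<le> 1 * \<epsilon>"
    using i(2) PQ by (intro mult_mono) auto
  finally show "\<exists>i\<in>{1..k}. norm (blinfun_apply (Q o\<^sub>L T o\<^sub>L P) x - norm P *\<^sub>R blinfun_apply Q (y i)) \<le> \<epsilon>"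
    using i(1) by (intro bexI[of _ i])
      (simp_all add: Pu blinfun.scaleR_right blinfun.diff_right scaleR_diff_right)
qed

lemma entropy_number_compose_le:
  assumes "k \<ge> 1" "norm Q * norm P \<le> 1"
  shows "entropy_number k (Q o\<^sub>L T o\<^sub>L P) \<le> entropy_number k T"
proof (rule dense_ge)
  fix \<epsilon> assume "entropy_number k T < \<epsilon>"
  then obtain y where "\<epsilon> > 0" "covers k T \<epsilon> y"
    using entropy_number_less_cover[OF assms(1)] by blast
  then show "entropy_number k (Q o\<^sub>L T o\<^sub>L P) \<le> \<epsilon>"
    using assms by (intro entropy_number_le[OF _ _ covers_compose]) auto
qed

section \<open>Lower semicontinuity of entropy numbers under pointwise convergence\<close>

lemma covers_pointwise_limit:
  fixes S :: "'n \<Rightarrow> 'a::real_normed_vector \<Rightarrow>\<^sub>L 'b::real_normed_vector"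
  assumes refl: "reflexive_space TYPE('b)"
    and F: "F \<noteq> bot"
    and cov: "eventually (\<lambda>n. covers k (S n) \<epsilon> (c n)) F"
    and bounded: "\<And>n i. norm (c n i) \<le> M"
    and lim: "\<And>x. ((\<lambda>n. blinfun_apply (S n) x) \<longlongrightarrow> blinfun_apply T x) F"
  obtains y where "covers k T \<epsilon> y"
proof -
  obtain y where y: "\<And>C. closed C \<Longrightarrow>
      eventually (\<lambda>n. (\<lambda>(i, f :: 'b \<Rightarrow>\<^sub>L real). blinfun_apply f (c n i)) \<in> C) F \<Longrightarrow>
      (\<lambda>(i, f :: 'b \<Rightarrow>\<^sub>L real). blinfun_apply f (y i)) \<in> C"
    by (rule reflexive_tuple_cluster_point[OF refl F bounded]) (rule that)
  have "covers k T \<epsilon> y"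
    unfolding covers_def
  proof (intro allI impI)
    fix x :: 'a assume x: "norm x \<le> 1"
    \<comment> \<open>The functionals depend on \<open>x\<close>, but the tuple \<open>y\<close> was
      fixed beforehand and serves all \<open>x\<close>.\<close>
    have "\<exists>f. norm f \<le> 1 \<and> blinfun_apply f (blinfun_apply T x - y i) = norm (blinfun_apply T x - y i)" for i
      using norming_functional by metis
    then obtain f where f: "\<And>i. norm (f i) \<le> 1"
      "\<And>i. blinfun_apply (f i) (blinfun_apply T x - y i) = norm (blinfun_apply T x - y i)"
      by metis
    \<comment> \<open>The slack \<open>\<delta>\<close> absorbs the distance between
      \<open>S n x\<close> and \<open>T x\<close>.\<close>
    have approx: "\<exists>i\<in>{1..k}. norm (blinfun_apply T x - y i) \<le> \<epsilon> + \<delta>" if "\<delta> > 0" for \<delta>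
    proof -
      \<comment> \<open>The union over \<open>i\<close> is taken because the ball containing
        \<open>S n x\<close> may change with \<open>n\<close>; being finite, it stays closed. At the
        tuple of \<open>y\<close> the left-hand side equals \<open>norm (T x - y i)\<close> by the
        choice of \<open>f i\<close>.\<close>
      define C where "C = (\<Union>i\<in>{1..k}. {w :: nat \<times> ('b \<Rightarrow>\<^sub>L real) \<Rightarrow> real.
          blinfun_apply (f i) (blinfun_apply T x) - w (i, f i) \<le> \<epsilon> + \<delta>})"
      have "closed C"
        unfolding C_def by (intro closed_UN ballI closed_Collect_le continuous_intros) auto
      moreover have "eventually (\<lambda>n. norm (blinfun_apply (S n) x - blinfun_apply T x) < \<delta>) F"
        using tendstoD[OF lim that] by (simp add: dist_norm)
      then have "eventually (\<lambda>n. (\<lambda>(i, f :: 'b \<Rightarrow>\<^sub>L real). blinfun_apply f (c n i)) \<in> C) F"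
        using cov
      proof eventually_elim
        case (elim n)
        obtain i where i: "i \<in> {1..k}" "norm (blinfun_apply (S n) x - c n i) \<le> \<epsilon>"
          using coversE[OF elim(2) x] .
        have "blinfun_apply (f i) (blinfun_apply T x) - blinfun_apply (f i) (c n i)
            \<le> norm (blinfun_apply (f i) (blinfun_apply T x - c n i))"
          by (simp add: blinfun.diff_right)
        also have "\<dots> \<le> norm (f i) * norm (blinfun_apply T x - c n i)"
          by (rule norm_blinfun)
        also have "\<dots> \<le> norm (blinfun_apply T x - c n i)"
          using mult_right_mono[OF f(1)[of i] norm_ge_zero] by simp
        also have "\<dots> \<le> norm (blinfun_apply T x - blinfun_apply (S n) x)
            + norm (blinfun_apply (S n) x - c n i)"
          using norm_triangle_ineq[of "blinfun_apply T x - blinfun_apply (S n) x"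
              "blinfun_apply (S n) x - c n i"] by simp
        also have "\<dots> \<le> \<epsilon> + \<delta>"
          using i(2) elim(1) by (simp add: norm_minus_commute)
        finally show ?case using i(1) by (auto simp: C_def)
      qed
      ultimately have "(\<lambda>(i, f :: 'b \<Rightarrow>\<^sub>L real). blinfun_apply f (y i)) \<in> C" by (rule y)
      then show ?thesis
        by (auto simp: C_def f(2)[symmetric] blinfun.diff_right)
    qed
    show "\<exists>i\<in>{1..k}. norm (blinfun_apply T x - y i) \<le> \<epsilon>"
    proof (rule ccontr)
      assume "\<not> ?thesis"
      then have gt: "norm (blinfun_apply T x - y i) > \<epsilon>" if "i \<in> {1..k}" for i
        using that by force
      have ne: "{1..k} \<noteq> {}" using approx[of 1] by auto
      \<comment> \<open>Only finitely many distances occur, so if all exceed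
        \<open>\<epsilon>\<close> then so does their minimum, and half the gap as slack gives a
        contradiction.\<close>
      define m where "m = Min ((\<lambda>i. norm (blinfun_apply T x - y i)) ` {1..k})"
      have m: "m > \<epsilon>" unfolding m_def using gt ne by (subst Min_gr_iff) auto
      obtain i where "i \<in> {1..k}" "norm (blinfun_apply T x - y i) \<le> \<epsilon> + (m - \<epsilon>) / 2"
        using approx[of "(m - \<epsilon>) / 2"] m by auto
      moreover have "m \<le> norm (blinfun_apply T x - y i)"
        unfolding m_def using calculation(1) by (intro Min_le) auto
      ultimately show False using m by (simp add: field_simps)
    qed
  qed
  then show thesis by (rule that)
qed

lemma entropy_number_eventually_greater:
  fixes S :: "nat \<Rightarrow> 'a::real_normed_vector \<Rightarrow>\<^sub>L 'b::real_normed_vector"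
  assumes refl: "reflexive_space TYPE('b)" and k: "k \<ge> 1"
    and bounded: "\<And>n. norm (S n) \<le> M"
    and lim: "\<And>x. (\<lambda>n. blinfun_apply (S n) x) \<longlonglongrightarrow> blinfun_apply T x"
    and a: "a < entropy_number k T"
  shows "eventually (\<lambda>n. a < entropy_number k (S n)) sequentially"
proof (rule ccontr)
  assume not_ev: "\<not> ?thesis"
  \<comment> \<open>The infimum need not be attained: radius \<open>b > a\<close> guarantees actual
    covers, and \<open>b\<close> below \<open>entropy_number k T\<close> keeps the
    contradiction.\<close>
  obtain b where b: "a < b" "b < entropy_number k T" using dense[OF a] by blast
  define N where "N = {n. entropy_number k (S n) \<le> a}"
  \<comment> \<open>Passing to the subsequence of bad indices, as a filter; it is proper because
    \<open>N\<close> is met arbitrarily far out.\<close>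
  define F where "F = inf sequentially (principal N)"
  have F: "F \<noteq> bot"
  proof
    assume "F = bot"
    then have "eventually (\<lambda>n. n \<notin> N) sequentially"
      by (simp add: F_def trivial_limit_def eventually_inf_principal)
    then show False using not_ev by (simp add: N_def not_le)
  qed
  have F_le: "F \<le> sequentially" by (simp add: F_def)
  have "\<exists>c. n \<in> N \<longrightarrow> b > 0 \<and> covers k (S n) b c \<and> (\<forall>i. norm (c i) \<le> M + b)" for n
  proof (cases "n \<in> N")
    case True
    then have "entropy_number k (S n) < b" using b(1) by (simp add: N_def)
    then obtain y where "b > 0" "covers k (S n) b y"
      using entropy_number_less_cover[OF k] by blast
    then show ?thesis using covers_bounded_centers[OF _ _ bounded] by metis
  qed simp
  then obtain c0 where c0: "\<And>n. n \<in> N \<Longrightarrow> b > 0 \<and> covers k (S n) b (c0 n) \<and> (\<forall>i. norm (c0 n i) \<le> M + b)"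
    by metis
  \<comment> \<open>The value 0 off \<open>N\<close> makes the norm bound hold for all
    \<open>n\<close>, while \<open>F\<close> only sees indices in \<open>N\<close>.\<close>
  define c where "c n = (if n \<in> N then c0 n else (\<lambda>_. 0))" for n
  have "N \<noteq> {}" using F by (auto simp: F_def)
  then have "b > 0" using c0 by blast
  have "M \<ge> 0" using bounded[of 0] norm_ge_zero[of "S 0"] by linarith
  have "norm (c n i) \<le> M + b" for n i
    using c0 \<open>b > 0\<close> \<open>M \<ge> 0\<close> by (simp add: c_def)
  moreover have "eventually (\<lambda>n. covers k (S n) b (c n)) F"
    using c0 by (auto simp: F_def c_def eventually_inf_principal)
  moreover have "((\<lambda>n. blinfun_apply (S n) x) \<longlongrightarrow> blinfun_apply T x) F" for x
    by (rule tendsto_mono[OF F_le lim])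
  ultimately obtain y where "covers k T b y"
    using covers_pointwise_limit[OF refl F] by blast
  then have "entropy_number k T \<le> b" using entropy_number_le[OF k \<open>b > 0\<close>] by blast
  then show False using b(2) by simp
qed

theorem theorem2p3:
  fixes T :: "'a::real_normed_vector \<Rightarrow>\<^sub>L 'b::banach"
    and P :: "nat \<Rightarrow> ('a \<Rightarrow>\<^sub>L 'a)"
    and Q :: "nat \<Rightarrow> ('b \<Rightarrow>\<^sub>L 'b)"
    and Tn :: "nat \<Rightarrow> ('a \<Rightarrow>\<^sub>L 'b)"
    and k :: nat
  assumes "reflexive_space TYPE('b)"
    and "\<And>n. norm (Q n) * norm (P n) \<le> 1"
    and "\<And>n. Tn n = Q n o\<^sub>L T o\<^sub>L P n"
    and "\<And>x. (\<lambda>n. norm (blinfun_apply (Tn n) x - blinfun_apply T x)) \<longlonglongrightarrow> 0"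
    and "k \<ge> 1"
  shows "(\<lambda>n. entropy_number k (Tn n)) \<longlonglongrightarrow> entropy_number k T"
proof (rule order_tendstoI)
  fix a assume a: "a < entropy_number k T"
  have "norm (Tn n) \<le> norm T" for n
  proof -
    have "norm (Tn n) \<le> norm (Q n) * norm T * norm (P n)"
      unfolding assms(3)[of n]
      by (rule order_trans[OF norm_blinfun_compose mult_right_mono[OF norm_blinfun_compose norm_ge_zero]])
    also have "\<dots> = norm (Q n) * norm (P n) * norm T" by simp
    also have "\<dots> \<le> norm T"
      using mult_right_mono[OF assms(2)[of n] norm_ge_zero[of T]] by simp
    finally show ?thesis .
  qed
  moreover have "(\<lambda>n. blinfun_apply (Tn n) x) \<longlonglongrightarrow> blinfun_apply T x" for x
    using assms(4)[of x] by (simp add: LIM_zero_iff tendsto_norm_zero_iff)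
  ultimately show "\<forall>\<^sub>F n in sequentially. a < entropy_number k (Tn n)"
    using entropy_number_eventually_greater[OF assms(1,5) _ _ a] by blast
next
  \<comment> \<open>The upper half holds for every \<open>n\<close>, by the composition
    inequality.\<close>
  fix a assume "entropy_number k T < a"
  then show "\<forall>\<^sub>F n in sequentially. entropy_number k (Tn n) < a"
    using entropy_number_compose_le[OF assms(5,2)] assms(3)
    by (intro always_eventually allI) (metis order_le_less_trans)
qed

end
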